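(* (Type C) For every group $\mathcal{G}$ of type C there exist positive integers $m$, $n$ with $n$ a divisor of $m$, and an integer $k\in\{0,1,\ldots,r-1\}$, where $r=m/n$, satisfying $$1+k+k^2\equiv 0 \pmod r,$$ such that in a certain basis of $\mathbb{C}^3$ the group $\mathcal{G}$ is generated by the matrices $E$, $F$ and $G$, where $$F=\mathrm{diag}\left(\epsilon,\epsilon^{k},\epsilon^{-k-1}\right),\qquad G=\mathrm{diag}\left(1,\epsilon^{-r},\epsilon^{r}\right),\qquad \epsilon=\exp(2\pi i/m).$$ (Type D) For every group $\mathcal{G}$ of type D there exist positive integers $m$, $n$ with $n$ a divisor of $m$, and an integer $k\in\{0,1,\ldots,r-1\}$, where $r=m/n$, satisfying both $$1+k+k^2\equiv 0 \pmod r\qquad\text{and}\qquad 1+2k\equiv 0\pmod r,$$ such that in a certain basis of $\mathbb{C}^3$ the group $\mathcal{G}$ is generated by $E$, $F$, $G$ and $B$, with $F$, $G$ given by the same formulas.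
   Context: Matrices: $$E=\begin{pmatrix}0&1&0\\0&0&1\\1&0&0\end{pmatrix},\qquad B=\begin{pmatrix}-1&0&0\\0&0&-1\\0&-1&0\end{pmatrix}.$$ For integers $\mu\ge 1$, $0\le\alpha,\beta<\mu$ let $F(\mu,\alpha,\beta)=\mathrm{diag}(\eta^{\alpha},\eta^{\beta},\eta^{-\alpha-\beta})$ with $\eta=e^{2\pi i/\mu}$. For integers $\nu\ge 1$, $0\le\rho,\sigma<\nu$ let $$R(\nu,\rho,\sigma)=\begin{pmatrix}\delta^{\rho}&0&0\\0&0&\delta^{\sigma}\\0&-\delta^{-\rho-\sigma}&0\end{pmatrix},\qquad \delta=e^{2\pi i/\nu}.$$ A group of type C is a finite subgroup of $SU(3)$ generated by $E$ and some $F(\mu,\alpha,\beta)$. A group of type D is a finite subgroup of $SU(3)$ generated by $E$, some $F(\mu,\alpha,\beta)$ and some $R(\nu,\rho,\sigma)$. "In a certain basis of $\mathbb{C}^3$ the group $\mathcal{G}$ is generated by ..." means that there is an invertible matrix $S$ such that $S\mathcal{G}S^{-1}$ is the group generated by the listed matrices. *)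

theory Defs
  imports
    "HOL-Analysis.Analysis"
    "HOL-Algebra.Generated_Groups"
    "HOL-Number_Theory.Cong"
begin

text \<open>
  The ambient group for \<^term>\<open>generate\<close> is the full general linear group rather than the special
  unitary group, since a change of basis by an arbitrary invertible matrix need not preserve the
  latter.
\<close>

type_synonym cmat3 = "complex^3^3"

definition GL3 :: "cmat3 monoid" where
  "GL3 = \<lparr>carrier = {A. invertible A}, monoid.mult = (**), one = mat 1\<rparr>"

definition adjoint3 :: "cmat3 \<Rightarrow> cmat3" where
  "adjoint3 A = (\<chi> i j. cnj (A $ j $ i))"

definition SU3 :: "cmat3 set" where
  "SU3 = {A. A ** adjoint3 A = mat 1 \<and> adjoint3 A ** A = mat 1 \<and> det A = 1}"

definition unity_root :: "nat \<Rightarrow> complex" where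
  "unity_root m = exp (2 * of_real pi * \<i> / of_nat m)"

definition diag3 :: "complex \<Rightarrow> complex \<Rightarrow> complex \<Rightarrow> cmat3" where
  "diag3 a b c = vector [vector [a, 0, 0], vector [0, b, 0], vector [0, 0, c]]"

definition E_mat :: cmat3 where
  "E_mat = vector [vector [0, 1, 0], vector [0, 0, 1], vector [1, 0, 0]]"

definition B_mat :: cmat3 where
  "B_mat = vector [vector [-1, 0, 0], vector [0, 0, -1], vector [0, -1, 0]]"

definition F_mat :: "nat \<Rightarrow> nat \<Rightarrow> nat \<Rightarrow> cmat3" where
  "F_mat \<mu> \<alpha> \<beta> =
     (let \<eta> = unity_root \<mu>
      in diag3 (\<eta> ^ \<alpha>) (\<eta> ^ \<beta>) (\<eta> powi (- int \<alpha> - int \<beta>)))"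

definition R_mat :: "nat \<Rightarrow> nat \<Rightarrow> nat \<Rightarrow> cmat3" where
  "R_mat \<nu> \<rho> \<sigma> =
     (let \<delta> = unity_root \<nu>
      in vector [vector [\<delta> ^ \<rho>, 0, 0],
                 vector [0, 0, \<delta> ^ \<sigma>],
                 vector [0, - (\<delta> powi (- int \<rho> - int \<sigma>)), 0]])"

definition type_C :: "cmat3 set \<Rightarrow> bool" where
  "type_C \<G> \<longleftrightarrow> subgroup \<G> GL3 \<and> \<G> \<subseteq> SU3 \<and> finite \<G> \<and>
     (\<exists>\<mu> \<alpha> \<beta>. \<mu> \<ge> 1 \<and> \<alpha> < \<mu> \<and> \<beta> < \<mu> \<and>
        \<G> = generate GL3 {E_mat, F_mat \<mu> \<alpha> \<beta>})"

definition type_D :: "cmat3 set \<Rightarrow> bool" where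
  "type_D \<G> \<longleftrightarrow> subgroup \<G> GL3 \<and> \<G> \<subseteq> SU3 \<and> finite \<G> \<and>
     (\<exists>\<mu> \<alpha> \<beta> \<nu> \<rho> \<sigma>. \<mu> \<ge> 1 \<and> \<alpha> < \<mu> \<and> \<beta> < \<mu> \<and> \<nu> \<ge> 1 \<and> \<rho> < \<nu> \<and> \<sigma> < \<nu> \<and>
        \<G> = generate GL3 {E_mat, F_mat \<mu> \<alpha> \<beta>, R_mat \<nu> \<rho> \<sigma>})"

definition generated_in_some_basis :: "cmat3 set \<Rightarrow> cmat3 set \<Rightarrow> bool" where
  "generated_in_some_basis \<G> X \<longleftrightarrow>
     (\<exists>S. invertible S \<and> (\<lambda>A. S ** A ** matrix_inv S) ` \<G> = generate GL3 X)"

definition F_normal :: "nat \<Rightarrow> nat \<Rightarrow> cmat3" where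
  "F_normal m k =
     (let \<epsilon> = unity_root m in diag3 \<epsilon> (\<epsilon> ^ k) (\<epsilon> powi (- int k - 1)))"

definition G_normal :: "nat \<Rightarrow> nat \<Rightarrow> cmat3" where
  "G_normal m r =
     (let \<epsilon> = unity_root m in diag3 1 (\<epsilon> powi (- int r)) (\<epsilon> ^ r))"

lemma group_GL3: "group GL3"
proof (rule groupI)
  fix x assume "x \<in> carrier GL3"
  then show "\<exists>y\<in>carrier GL3. y \<otimes>\<^bsub>GL3\<^esub> x = \<one>\<^bsub>GL3\<^esub>"
    by (auto simp: GL3_def invertible_def)
qed (auto simp: GL3_def invertible_mult matrix_mul_assoc[symmetric] invertible_def[of "mat 1"] intro: exI[of _ "mat 1"])

lemma adjoint3_mult: "adjoint3 (A ** B) = adjoint3 B ** adjoint3 A"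
  by (simp add: adjoint3_def matrix_matrix_mult_def vec_eq_iff mult.commute)

lemma adjoint3_adjoint3 [simp]: "adjoint3 (adjoint3 A) = A"
  by (simp add: adjoint3_def vec_eq_iff)

lemma subgroup_SU3: "subgroup SU3 GL3"
proof
  show sub: "SU3 \<subseteq> carrier GL3"
    by (auto simp: SU3_def GL3_def invertible_def)
  show "x \<otimes>\<^bsub>GL3\<^esub> y \<in> SU3" if "x \<in> SU3" "y \<in> SU3" for x y
  proof -
    have "(x ** y) ** (adjoint3 y ** adjoint3 x) = x ** (y ** adjoint3 y) ** adjoint3 x"
      and "(adjoint3 y ** adjoint3 x) ** (x ** y) = adjoint3 y ** (adjoint3 x ** x) ** y"
      by (simp_all add: matrix_mul_assoc)
    then show ?thesis
      using that by (simp add: SU3_def GL3_def adjoint3_mult det_mul)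
  qed
  have "adjoint3 (mat 1) = mat 1"
    by (auto simp: adjoint3_def mat_def vec_eq_iff)
  then show "\<one>\<^bsub>GL3\<^esub> \<in> SU3"
    by (simp add: SU3_def GL3_def)
  show "inv\<^bsub>GL3\<^esub> x \<in> SU3" if x: "x \<in> SU3" for x
  proof -
    have d: "det (adjoint3 x) = 1"
      using x det_mul[of x "adjoint3 x"] by (simp add: SU3_def)
    then have adj: "adjoint3 x \<in> SU3"
      using x by (simp add: SU3_def)
    have "inv\<^bsub>GL3\<^esub> x = adjoint3 x"
      using x adj subsetD[OF sub x] subsetD[OF sub adj]
      by (intro group.inv_equality[OF group_GL3]) (simp_all add: SU3_def GL3_def)
    then show ?thesis
      using adj by simp
  qed
qed

lemma unity_root_cnj: "unity_root m * cnj (unity_root m) = 1"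
  by (simp add: unity_root_def complex_norm_square[symmetric])

lemma unity_root_nonzero [simp]: "unity_root m \<noteq> 0"
  by (simp add: unity_root_def)

lemma cnj_unity_root: "cnj (unity_root m) = inverse (unity_root m)"
  using unity_root_cnj[of m] by (metis inverse_unique)

lemma E_mat_in_SU3: "E_mat \<in> SU3"
  by (simp add: SU3_def E_mat_def adjoint3_def det_3 matrix_matrix_mult_def vec_eq_iff
      forall_3 sum_3 mat_def)

lemma B_mat_in_SU3: "B_mat \<in> SU3"
  by (simp add: SU3_def B_mat_def adjoint3_def det_3 matrix_matrix_mult_def vec_eq_iff
      forall_3 sum_3 mat_def)

lemma F_mat_in_SU3: "F_mat \<mu> \<alpha> \<beta> \<in> SU3"
  by (simp add: SU3_def F_mat_def Let_def diag3_def adjoint3_def det_3 matrix_matrix_mult_def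
      vec_eq_iff forall_3 sum_3 mat_def cnj_unity_root power_int_minus power_int_diff
      power_inverse field_simps)

lemma R_mat_in_SU3: "R_mat \<nu> \<rho> \<sigma> \<in> SU3"
  by (simp add: SU3_def R_mat_def Let_def adjoint3_def det_3 matrix_matrix_mult_def
      vec_eq_iff forall_3 sum_3 mat_def cnj_unity_root power_int_minus power_int_diff
      power_inverse field_simps)

lemma B_mat_eq_R_mat: "B_mat = R_mat 2 1 1"
proof -
  have "unity_root 2 = -1"
    by (simp add: unity_root_def)
  then show ?thesis
    by (simp add: B_mat_def R_mat_def Let_def)
qed

end

theory Submission
  imports Defs
begin

text \<open>
  Let \<open>D\<close> be the group of diagonal matrices in \<open>\<G>\<close>, viewed as a finite group of pairs of complex
  numbers. Its projection to the first coordinate is the group of \<open>m\<close>-th roots of unity, and the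
  kernel of the projection is the group of \<open>n\<close>-th roots of unity. Conjugation by \<open>E\<close> acts by
  \<open>(a, b) \<mapsto> (b, 1/(ab))\<close>; invariance under it gives \<open>n dvd m\<close>, shows that the second coordinate of a
  lift of \<open>\<epsilon>\<close> may be taken to be \<open>\<epsilon> ^ k\<close> with \<open>k < r\<close>, and forces \<open>r dvd 1 + k + k\<^sup>2\<close>. So \<open>F\<close> and \<open>G\<close>
  generate \<open>D\<close>, which settles type C without any change of basis.

  For type D write \<open>R = X B\<close> with \<open>X\<close> diagonal and change the basis by \<open>X\<close>. Modulo \<open>D\<close>, the matrix \<open>X\<close> is
  invariant under \<open>E\<close> (since \<open>R E R\<^sup>-\<^sup>1 E\<close> lies in \<open>D\<close>) and inverted by \<open>B\<close> (since \<open>R\<^sup>2\<close> lies in \<open>D\<close>),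
  and \<open>X\<^sup>3\<close> is trivial because the product of the three rotations of \<open>X\<close> is \<open>1\<close>. Hence \<open>X E X\<^sup>-\<^sup>1\<close> lies in
  \<open>D E\<close> and \<open>X R X\<^sup>-\<^sup>1\<close> lies in \<open>X\<^sup>3 D B = D B\<close>. Invariance of \<open>D\<close> under \<open>B\<close> yields \<open>r dvd 1 + 2 k\<close>.
\<close>

section \<open>Finite groups of pairs of complex numbers\<close>

lemma unity_root_power: "unity_root m ^ i = exp (2 * of_real pi * \<i> * of_nat i / of_nat m)"
  by (simp add: unity_root_def exp_of_nat_mult [symmetric] mult_ac)

lemma unity_root_power_self [simp]: "m > 0 \<Longrightarrow> unity_root m ^ m = 1"
  by (simp add: unity_root_power)

lemma unity_root_power_eq_1_iff:
  assumes "m > 0"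
  shows "unity_root m ^ i = 1 \<longleftrightarrow> m dvd i"
  using complex_root_unity_eq_1[of m i] assms by (simp add: unity_root_power)

lemma root_of_unity_obtain:
  assumes "m > 0" "z ^ m = 1"
  obtains i where "z = unity_root m ^ i"
proof -
  from assms complex_roots_unity[of m] obtain j
    where "z = exp (2 * of_real pi * \<i> * of_nat j / of_nat m)"
    by auto
  then show ?thesis
    using that unity_root_power by metis
qed

lemma unity_root_mult_power:
  assumes "n > 0" "r > 0"
  shows "unity_root (n * r) ^ r = unity_root n"
  unfolding unity_root_power using assms by (simp add: unity_root_def)

text \<open>Multiplication by \<open>a\<close> permutes \<open>A\<close>, so comparing the product
  of all elements before and after gives \<open>a ^ card A = 1\<close>. There are only
  \<open>card A\<close> such roots of unity, which turns the inclusion into an equality.\<close>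

lemma finite_mult_closed_eq_roots_of_unity:
  fixes A :: "complex set"
  assumes fin: "finite A" and ne: "A \<noteq> {}" and nz: "0 \<notin> A"
    and mult: "\<And>a b. a \<in> A \<Longrightarrow> b \<in> A \<Longrightarrow> a * b \<in> A"
  shows "A = {z. z ^ card A = 1}"
proof (rule card_subset_eq)
  have pos: "card A > 0"
    using fin ne by (simp add: card_gt_0_iff)
  show "finite {z::complex. z ^ card A = 1}"
    using pos finite_roots_unity[of "card A"] by simp
  show "A \<subseteq> {z. z ^ card A = 1}"
  proof
    fix a assume a: "a \<in> A"
    then have "inj_on ((*) a) A"
      using nz by (auto simp: inj_on_def)
    moreover from this have "(*) a ` A = A"
      using fin mult a by (intro endo_inj_surj) auto
    ultimately have "\<Prod>A = (\<Prod>x\<in>A. a * x)"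
      using prod.reindex[of "(*) a" A "\<lambda>x. x"] by simp
    also have "\<dots> = a ^ card A * \<Prod>A"
      by (simp add: prod.distrib)
    finally show "a \<in> {z. z ^ card A = 1}"
      using nz fin by auto
  qed
  show "card A = card {z::complex. z ^ card A = 1}"
    using pos card_roots_unity_eq[of "card A"] by simp
qed

text \<open>A pair \<open>(a, b)\<close> stands for \<open>diag3 a b (inverse (a * b))\<close>. Then
  \<open>rot\<close> is conjugation by \<open>E_mat\<close>, and the premise of the last conclusion
  is conjugation by \<open>B_mat\<close>. Generation is expressed through an arbitrary
  multiplicatively closed \<open>K\<close>, so that \<open>K\<close> can later be the diagonal part
  of any matrix group.\<close>

lemma cyclic_pair_group_normal_form:
  fixes H :: "(complex \<times> complex) set"
  assumes fin: "finite H" and one: "(1, 1) \<in> H"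
    and nz: "\<And>a b. (a, b) \<in> H \<Longrightarrow> a \<noteq> 0 \<and> b \<noteq> 0"
    and mult: "\<And>a b c d. (a, b) \<in> H \<Longrightarrow> (c, d) \<in> H \<Longrightarrow> (a * c, b * d) \<in> H"
    and inv: "\<And>a b. (a, b) \<in> H \<Longrightarrow> (inverse a, inverse b) \<in> H"
    and rot: "\<And>a b. (a, b) \<in> H \<Longrightarrow> (b, inverse (a * b)) \<in> H"
  obtains m n k r :: nat
  where "0 < m" "0 < n" "n dvd m" "r = m div n" "k < r" "[1 + k + k ^ 2 = 0] (mod r)"
    and "(unity_root m, unity_root m ^ k) \<in> H"
    and "(1, inverse (unity_root m ^ r)) \<in> H"
    and "\<And>K. (1, 1) \<in> K \<Longrightarrow>
           (\<And>a b c d. (a, b) \<in> K \<Longrightarrow> (c, d) \<in> K \<Longrightarrow> (a * c, b * d) \<in> K) \<Longrightarrow>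
           (unity_root m, unity_root m ^ k) \<in> K \<Longrightarrow>
           (1, inverse (unity_root m ^ r)) \<in> K \<Longrightarrow> H \<subseteq> K"
    and "(\<And>a b. (a, b) \<in> H \<Longrightarrow> (a, inverse (a * b)) \<in> H) \<Longrightarrow> [1 + 2 * k = 0] (mod r)"
proof -
  define A where "A = fst ` H"
  define N where "N = {b. (1, b) \<in> H}"
  define m where "m = card A"
  define n where "n = card N"
  define r where "r = m div n"
  define \<epsilon> where "\<epsilon> = unity_root m"
  have finA: "finite A" and oneA: "1 \<in> A"
    using fin one by (force simp: A_def)+
  have N_eq: "N = snd ` (H \<inter> {1} \<times> UNIV)"
    by (force simp: N_def)
  have finN: "finite N" and oneN: "1 \<in> N"
    using fin one by (simp_all add: N_eq) (simp add: N_def flip: N_eq)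
  have m: "m > 0" and n: "n > 0"
    using finA oneA finN oneN by (auto simp: m_def n_def card_gt_0_iff)
  have A: "A = {z. z ^ m = 1}"
    unfolding m_def
  proof (rule finite_mult_closed_eq_roots_of_unity[OF finA])
    show "a * b \<in> A" if "a \<in> A" "b \<in> A" for a b
      using that mult by (force simp: A_def)
  qed (use nz oneA in \<open>auto simp: A_def\<close>)
  have N: "N = {z. z ^ n = 1}"
    unfolding n_def
  proof (rule finite_mult_closed_eq_roots_of_unity[OF finN])
    show "a * b \<in> N" if "a \<in> N" "b \<in> N" for a b
      using that mult[of 1 a 1 b] by (simp add: N_def)
  qed (use nz oneN in \<open>auto simp: N_def\<close>)
  have fst_root: "a ^ m = 1" if "(a, b) \<in> H" for a b
    using that A by (force simp: A_def)
  have ker_iff: "(1, b) \<in> H \<longleftrightarrow> b ^ n = 1" for b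
    using N by (auto simp: N_def)
  \<comment> \<open>Rotation moves a kernel element into the first coordinate, so a primitive
    \<open>n\<close>-th root of unity is also an \<open>m\<close>-th root of unity.\<close>
  have "(1, unity_root n) \<in> H"
    using n by (simp add: ker_iff)
  then have "unity_root n ^ m = 1"
    using rot fst_root by blast
  then have dvd: "n dvd m"
    using n by (simp add: unity_root_power_eq_1_iff)
  then have m_eq: "m = n * r"
    by (simp add: r_def)
  with m have r: "r > 0"
    by simp
  have root: "\<epsilon> ^ r = unity_root n"
    using unity_root_mult_power[OF n r] by (simp add: \<epsilon>_def m_eq)
  \<comment> \<open>Both congruences for \<open>k\<close> are read off from this equivalence, by
    exhibiting suitable pairs with first coordinate 1.\<close>
  have \<epsilon>_ker_iff: "(1, \<epsilon> ^ i) \<in> H \<longleftrightarrow> r dvd i" for i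
  proof -
    have "(1, \<epsilon> ^ i) \<in> H \<longleftrightarrow> m dvd i * n"
      using m by (simp add: ker_iff \<epsilon>_def unity_root_power_eq_1_iff flip: power_mult)
    then show ?thesis
      using n by (simp add: m_eq mult.commute)
  qed
  have \<epsilon>nz [simp]: "\<epsilon> \<noteq> 0"
    by (simp add: \<epsilon>_def)
  have "\<epsilon> \<in> A"
    using m by (simp add: A \<epsilon>_def)
  then obtain c where c: "(\<epsilon>, c) \<in> H"
    by (auto simp: A_def)
  \<comment> \<open>After rotation \<open>c\<close> is itself a first coordinate, hence a power of
    \<open>\<epsilon>\<close>.\<close>
  then have "c ^ m = 1"
    using rot fst_root by blast
  then obtain l where l: "c = \<epsilon> ^ l"
    using root_of_unity_obtain[OF m] unfolding \<epsilon>_def by blast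
  define k where "k = l mod r"
  \<comment> \<open>Dividing \<open>(\<epsilon>, \<epsilon> ^ l)\<close> by this kernel element
    reduces the exponent \<open>l\<close> modulo \<open>r\<close>.\<close>
  have "(1, \<epsilon> ^ (r * (l div r))) \<in> H"
    by (simp add: \<epsilon>_ker_iff)
  from mult[OF c inv[OF this]] have "(\<epsilon>, \<epsilon> ^ l * inverse (\<epsilon> ^ (r * (l div r)))) \<in> H"
    by (simp add: l)
  moreover have "\<epsilon> ^ l = \<epsilon> ^ k * \<epsilon> ^ (r * (l div r))"
    by (simp add: k_def flip: power_add)
  ultimately have F: "(\<epsilon>, \<epsilon> ^ k) \<in> H"
    by (simp add: mult.assoc)
  have pow: "(a ^ i, b ^ i) \<in> K" if "(a, b) \<in> K" "(1, 1) \<in> K"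
    "\<And>a b c d. (a, b) \<in> K \<Longrightarrow> (c, d) \<in> K \<Longrightarrow> (a * c, b * d) \<in> K"
    for a b i and K :: "(complex \<times> complex) set"
    using that by (induction i) auto
  have Fpow: "(\<epsilon> ^ i, (\<epsilon> ^ k) ^ i) \<in> H" for i
    using pow[OF F one mult, of i] by simp
  have "(1, \<epsilon> ^ (1 + k + k\<^sup>2)) \<in> H"
  proof -
    \<comment> \<open>This is the \<open>k\<close>-th power of
      \<open>(\<epsilon>, \<epsilon> ^ k)\<close> divided by the rotation of that pair; both have
      first coordinate \<open>\<epsilon> ^ k\<close>.\<close>
    have "(\<epsilon> ^ k * inverse (\<epsilon> ^ k), (\<epsilon> ^ k) ^ k * inverse (inverse (\<epsilon> * \<epsilon> ^ k))) \<in> H"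
      by (intro mult inv rot F Fpow)
    then show ?thesis
      by (simp add: power_add power2_eq_square power_mult mult_ac)
  qed
  then have k1: "[1 + k + k\<^sup>2 = 0] (mod r)"
    by (simp only: \<epsilon>_ker_iff cong_0_iff)
  have G: "(1, inverse (\<epsilon> ^ r)) \<in> H"
    using inv[of 1 "\<epsilon> ^ r"] \<epsilon>_ker_iff[of r] by simp
  have gen: "H \<subseteq> K" if K: "(1, 1) \<in> K"
    "\<And>a b c d. (a, b) \<in> K \<Longrightarrow> (c, d) \<in> K \<Longrightarrow> (a * c, b * d) \<in> K"
    "(\<epsilon>, \<epsilon> ^ k) \<in> K" "(1, inverse (\<epsilon> ^ r)) \<in> K" for K
  proof
    fix p assume p: "p \<in> H"
    obtain a b where ab: "p = (a, b)"
      by force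
    obtain i where i: "a = \<epsilon> ^ i"
      using root_of_unity_obtain[OF m fst_root] p unfolding ab \<epsilon>_def by blast
    \<comment> \<open>Dividing the \<open>i\<close>-th power of the first generator by
      \<open>p\<close> leaves a kernel element, which is a power of
      \<open>\<epsilon> ^ r\<close>.\<close>
    have "(1, (\<epsilon> ^ k) ^ i * inverse b) \<in> H"
      using mult[OF Fpow[of i] inv[OF p[unfolded ab]]] by (simp add: i)
    then have "((\<epsilon> ^ k) ^ i * inverse b) ^ n = 1"
      by (simp only: ker_iff)
    then obtain j where j: "(\<epsilon> ^ k) ^ i * inverse b = (\<epsilon> ^ r) ^ j"
      using root_of_unity_obtain[OF n] unfolding root by blast
    have "b \<noteq> 0"
      using nz p ab by blast
    with j have "b = (\<epsilon> ^ k) ^ i * inverse (\<epsilon> ^ r) ^ j"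
      by (simp add: field_simps power_inverse)
    moreover have "(\<epsilon> ^ i * 1 ^ j, (\<epsilon> ^ k) ^ i * inverse (\<epsilon> ^ r) ^ j) \<in> K"
      by (rule K(2)[OF pow[OF K(3,1,2)] pow[OF K(4,1,2)]])
    ultimately show "p \<in> K"
      by (simp add: ab i)
  qed
  have refl: "[1 + 2 * k = 0] (mod r)" if "\<And>a b. (a, b) \<in> H \<Longrightarrow> (a, inverse (a * b)) \<in> H"
  proof -
    \<comment> \<open>The pair \<open>(\<epsilon>, \<epsilon> ^ k)\<close> is divided by its
      reflection, which has the same first coordinate.\<close>
    have "(\<epsilon> * inverse \<epsilon>, \<epsilon> ^ k * inverse (inverse (\<epsilon> * \<epsilon> ^ k))) \<in> H"
      by (intro mult inv that F)
    then have "(1, \<epsilon> ^ (1 + 2 * k)) \<in> H"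
      by (simp add: power_add power_mult power2_eq_square mult_ac)
    then show ?thesis
      by (simp only: \<epsilon>_ker_iff cong_0_iff)
  qed
  show thesis
    by (rule that[OF m n dvd r_def _ k1 F[unfolded \<epsilon>_def] G[unfolded \<epsilon>_def] gen[unfolded \<epsilon>_def] refl])
      (use r in \<open>auto simp: k_def\<close>)
qed

section \<open>Monomial matrices\<close>

lemma mult_GL3 [simp]: "A \<otimes>\<^bsub>GL3\<^esub> C = A ** C"
  by (simp add: GL3_def)

lemma one_GL3 [simp]: "\<one>\<^bsub>GL3\<^esub> = mat 1"
  by (simp add: GL3_def)

lemma carrier_GL3: "A \<in> carrier GL3 \<longleftrightarrow> invertible A"
  by (simp add: GL3_def)

lemma diag3_mult: "diag3 a b c ** diag3 a' b' c' = diag3 (a * a') (b * b') (c * c')"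
  by (simp add: diag3_def matrix_matrix_mult_def vec_eq_iff forall_3 sum_3)

lemma diag3_one: "diag3 1 1 1 = mat 1"
  by (simp add: diag3_def mat_def vec_eq_iff forall_3)

lemma det_diag3: "det (diag3 a b c) = a * b * c"
  by (simp add: diag3_def det_3)

lemma E_diag3: "E_mat ** diag3 a b c = diag3 b c a ** E_mat"
  by (simp add: E_mat_def diag3_def matrix_matrix_mult_def vec_eq_iff forall_3 sum_3)

lemma B_diag3: "B_mat ** diag3 a b c = diag3 a c b ** B_mat"
  by (simp add: B_mat_def diag3_def matrix_matrix_mult_def vec_eq_iff forall_3 sum_3)

lemma E_cubed: "E_mat ** (E_mat ** E_mat) = mat 1"
  by (simp add: E_mat_def mat_def matrix_matrix_mult_def vec_eq_iff forall_3 sum_3)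

lemma B_squared: "B_mat ** B_mat = mat 1"
  by (simp add: B_mat_def mat_def matrix_matrix_mult_def vec_eq_iff forall_3 sum_3)

lemma B_E_B: "B_mat ** E_mat ** B_mat = E_mat ** E_mat"
  by (simp add: B_mat_def E_mat_def matrix_matrix_mult_def vec_eq_iff forall_3 sum_3)

text \<open>The signs of the diagonal factor compensate the entries -1 of \<open>B_mat\<close>. The
  factor has determinant 1 and serves as the change of basis for type D.\<close>

lemma R_mat_eq:
  "R_mat \<nu> \<rho> \<sigma> = diag3 (- (unity_root \<nu> ^ \<rho>)) (- (unity_root \<nu> ^ \<sigma>))
     (unity_root \<nu> powi (- int \<rho> - int \<sigma>)) ** B_mat"
  by (simp add: R_mat_def Let_def B_mat_def diag3_def matrix_matrix_mult_def vec_eq_iff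
      forall_3 sum_3)

lemma diag3_inverse:
  assumes "a \<noteq> 0" "b \<noteq> 0" "c \<noteq> 0"
  shows "diag3 a b c ** diag3 (inverse a) (inverse b) (inverse c) = mat 1"
    and "diag3 (inverse a) (inverse b) (inverse c) ** diag3 a b c = mat 1"
  using assms by (simp_all add: diag3_mult diag3_one)

lemma invertible_diag3: "a \<noteq> 0 \<Longrightarrow> b \<noteq> 0 \<Longrightarrow> c \<noteq> 0 \<Longrightarrow> invertible (diag3 a b c)"
  using diag3_inverse unfolding invertible_def by blast

lemma matrix_inv_mult:
  assumes "invertible S"
  shows "S ** matrix_inv S = mat 1" "matrix_inv S ** S = mat 1"
proof -
  have "\<exists>S'. S ** S' = mat 1 \<and> S' ** S = mat 1"
    using assms by (simp add: invertible_def)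
  from someI_ex[OF this] show "S ** matrix_inv S = mat 1" "matrix_inv S ** S = mat 1"
    by (simp_all add: matrix_inv_def)
qed

lemma matrix_inv_diag3:
  assumes "a \<noteq> 0" "b \<noteq> 0" "c \<noteq> 0"
  shows "matrix_inv (diag3 a b c) = diag3 (inverse a) (inverse b) (inverse c)"
  using matrix_inv_mult(2)[OF invertible_diag3[OF assms]] diag3_inverse(1)[OF assms]
  by (metis matrix_mul_assoc matrix_mul_lid matrix_mul_rid)

lemma group_hom_conj:
  assumes "invertible S"
  shows "group_hom GL3 GL3 (\<lambda>A. S ** A ** matrix_inv S)"
proof -
  have "invertible (matrix_inv S)"
    using matrix_inv_mult[OF assms] unfolding invertible_def by blast
  moreover have "(S ** A ** matrix_inv S) ** (S ** C ** matrix_inv S) = S ** (A ** C) ** matrix_inv S" for A C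
  proof -
    have "(S ** A ** matrix_inv S) ** (S ** C ** matrix_inv S)
        = S ** A ** (matrix_inv S ** S) ** C ** matrix_inv S"
      by (simp only: matrix_mul_assoc)
    then show ?thesis
      by (simp add: matrix_inv_mult[OF assms] matrix_mul_assoc)
  qed
  ultimately show ?thesis
    using assms group_GL3
    by (auto simp: group_hom_def group_hom_axioms_def hom_def carrier_GL3 invertible_mult)
qed

lemma subgroup_GL3_mult: "subgroup K GL3 \<Longrightarrow> A \<in> K \<Longrightarrow> C \<in> K \<Longrightarrow> A ** C \<in> K"
  using subgroup.m_closed[of K GL3 A C] by simp

text \<open>By uniqueness of inverses \<open>C\<close> is the abstract group inverse of
  \<open>A\<close>; this makes closure under inversion usable with explicit matrices.\<close>

lemma subgroup_GL3_right_inverse: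
  assumes "subgroup K GL3" "A \<in> K" "A ** C = mat 1"
  shows "C \<in> K"
proof -
  have inv: "inv\<^bsub>GL3\<^esub> A \<in> K" and "inv\<^bsub>GL3\<^esub> A ** A = mat 1"
    using assms subgroup.m_inv_closed group.l_inv[OF group_GL3, of A] subgroup.mem_carrier
    by fastforce+
  then have "C = inv\<^bsub>GL3\<^esub> A"
    using assms(3) by (metis matrix_mul_assoc matrix_mul_lid matrix_mul_rid)
  with inv show ?thesis
    by simp
qed

lemma subgroup_GL3_diag3_mult:
  assumes "subgroup K GL3" "diag3 a b c \<in> K" "diag3 a' b' c' \<in> K"
  shows "diag3 (a * a') (b * b') (c * c') \<in> K"
  using subgroup_GL3_mult[OF assms] by (simp add: diag3_mult)

lemma subgroup_GL3_diag3_nonzero: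
  assumes "subgroup K GL3" "diag3 a b c \<in> K"
  shows "a \<noteq> 0" "b \<noteq> 0" "c \<noteq> 0"
  using subgroup.mem_carrier[OF assms] det_diag3[of a b c]
  by (auto simp: carrier_GL3 invertible_det_nz)

lemma subgroup_GL3_diag3_inverse:
  assumes "subgroup K GL3" "diag3 a b c \<in> K"
  shows "diag3 (inverse a) (inverse b) (inverse c) \<in> K"
  using subgroup_GL3_right_inverse[OF assms diag3_inverse(1)] subgroup_GL3_diag3_nonzero[OF assms]
  by blast

lemma subgroup_GL3_diag3_rotate:
  assumes K: "subgroup K GL3" and E: "E_mat \<in> K" and D: "diag3 a b c \<in> K"
  shows "diag3 b c a \<in> K"
proof -
  have "E_mat ** diag3 a b c ** (E_mat ** E_mat) \<in> K"
    by (intro subgroup_GL3_mult K E D)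
  also have "E_mat ** diag3 a b c ** (E_mat ** E_mat) = diag3 b c a ** (E_mat ** (E_mat ** E_mat))"
    by (simp add: E_diag3 matrix_mul_assoc)
  finally show ?thesis
    by (simp add: E_cubed)
qed

lemma subgroup_GL3_diag3_swap:
  assumes K: "subgroup K GL3" and B: "B_mat \<in> K" and D: "diag3 a b c \<in> K"
  shows "diag3 a c b \<in> K"
proof -
  have "B_mat ** diag3 a b c ** B_mat \<in> K"
    by (intro subgroup_GL3_mult K B D)
  also have "B_mat ** diag3 a b c ** B_mat = diag3 a c b ** (B_mat ** B_mat)"
    by (simp add: B_diag3 matrix_mul_assoc)
  finally show ?thesis
    by (simp add: B_squared)
qed

section \<open>The diagonal subgroup\<close>

lemma F_normal_eq:
  "F_normal m k = diag3 (unity_root m) (unity_root m ^ k) (inverse (unity_root m * unity_root m ^ k))"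
  by (simp add: F_normal_def Let_def power_int_diff power_int_minus field_simps)

lemma G_normal_eq:
  "G_normal m r = diag3 1 (inverse (unity_root m ^ r)) (inverse (1 * inverse (unity_root m ^ r)))"
  by (simp add: G_normal_def Let_def power_int_minus)

text \<open>Determinant 1 forces the third diagonal entry, so diagonal elements correspond to pairs,
  and the normal form for groups of pairs applies. Only the determinant is constrained, not
  unitarity, so the result also applies to a conjugate of the given group.\<close>

lemma diagonal_subgroup_normal_form:
  assumes sub: "subgroup \<G> GL3" and fin: "finite \<G>" and det: "\<And>A. A \<in> \<G> \<Longrightarrow> det A = 1"
    and E: "E_mat \<in> \<G>"
  obtains m n k r :: nat
  where "0 < m" "0 < n" "n dvd m" "r = m div n" "k < r" "[1 + k + k ^ 2 = 0] (mod r)"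
    and "F_normal m k \<in> \<G>" "G_normal m r \<in> \<G>"
    and "\<And>K a b c. subgroup K GL3 \<Longrightarrow> F_normal m k \<in> K \<Longrightarrow> G_normal m r \<in> K \<Longrightarrow>
           diag3 a b c \<in> \<G> \<Longrightarrow> diag3 a b c \<in> K"
    and "B_mat \<in> \<G> \<Longrightarrow> [1 + 2 * k = 0] (mod r)"
proof -
  \<comment> \<open>\<open>T\<close> is defined for every set of matrices because the generation
    property compares the pairs of \<open>\<G>\<close> with those of another subgroup.\<close>
  define T where "T K = {(a, b). diag3 a b (inverse (a * b)) \<in> K}" for K
  have T: "(a, b) \<in> T K \<longleftrightarrow> diag3 a b (inverse (a * b)) \<in> K" for a b K
    by (simp add: T_def)
  have third: "c = inverse (a * b)" if "diag3 a b c \<in> \<G>" for a b c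
    using det[OF that] by (metis det_diag3 inverse_unique)
  have one: "(1, 1) \<in> T K" if "subgroup K GL3" for K
    using subgroup.one_closed[OF that] by (simp add: T diag3_one)
  have mult: "(a * c, b * d) \<in> T K" if "subgroup K GL3" "(a, b) \<in> T K" "(c, d) \<in> T K" for K a b c d
    using subgroup_GL3_diag3_mult[OF that(1), of a b _ c d] that(2,3)
    by (fastforce simp: T mult_ac)
  have finT: "finite (T \<G>)"
  proof (rule inj_on_finite[OF _ _ fin])
    show "inj_on (\<lambda>(a, b). diag3 a b (inverse (a * b))) (T \<G>)"
      by (auto simp: inj_on_def diag3_def vec_eq_iff forall_3)
  qed (auto simp: T)
  have nz: "a \<noteq> 0 \<and> b \<noteq> 0" if "(a, b) \<in> T \<G>" for a b
    using subgroup_GL3_diag3_nonzero[OF sub] that by (auto simp: T)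
  have inv: "(inverse a, inverse b) \<in> T \<G>" if "(a, b) \<in> T \<G>" for a b
    using subgroup_GL3_diag3_inverse[OF sub] that by (fastforce simp: T)
  have rot: "(b, inverse (a * b)) \<in> T \<G>" if "(a, b) \<in> T \<G>" for a b
  proof -
    have "inverse (b * inverse (a * b)) = a"
      using nz[OF that] by (simp add: field_simps)
    then show ?thesis
      using subgroup_GL3_diag3_rotate[OF sub E that[unfolded T]] by (simp only: T)
  qed
  have swap: "(a, inverse (a * b)) \<in> T \<G>" if "(a, b) \<in> T \<G>" "B_mat \<in> \<G>" for a b
  proof -
    have "inverse (a * inverse (a * b)) = b"
      using nz[OF that(1)] by (simp add: field_simps)
    then show ?thesis
      using subgroup_GL3_diag3_swap[OF sub that(2) that(1)[unfolded T]] by (simp only: T)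
  qed
  show thesis
  proof (rule cyclic_pair_group_normal_form[OF finT one[OF sub] nz mult[OF sub] inv rot])
    fix m n k r :: nat
    assume norm: "0 < m" "0 < n" "n dvd m" "r = m div n" "k < r" "[1 + k + k ^ 2 = 0] (mod r)"
      and F: "(unity_root m, unity_root m ^ k) \<in> T \<G>"
      and G: "(1, inverse (unity_root m ^ r)) \<in> T \<G>"
      and gen: "\<And>K. (1, 1) \<in> K \<Longrightarrow>
             (\<And>a b c d. (a, b) \<in> K \<Longrightarrow> (c, d) \<in> K \<Longrightarrow> (a * c, b * d) \<in> K) \<Longrightarrow>
             (unity_root m, unity_root m ^ k) \<in> K \<Longrightarrow>
             (1, inverse (unity_root m ^ r)) \<in> K \<Longrightarrow> T \<G> \<subseteq> K"
      and refl: "(\<And>a b. (a, b) \<in> T \<G> \<Longrightarrow> (a, inverse (a * b)) \<in> T \<G>) \<Longrightarrow> [1 + 2 * k = 0] (mod r)"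
    have mem: "diag3 a b c \<in> K" if "subgroup K GL3" "F_normal m k \<in> K" "G_normal m r \<in> K"
      "diag3 a b c \<in> \<G>" for K a b c
    proof -
      have "T \<G> \<subseteq> T K"
      proof (rule gen)
        show "(1, 1) \<in> T K"
          by (rule one[OF that(1)])
        show "(a * c, b * d) \<in> T K" if "(a, b) \<in> T K" "(c, d) \<in> T K" for a b c d
          by (rule mult[OF \<open>subgroup K GL3\<close> that])
        show "(unity_root m, unity_root m ^ k) \<in> T K"
          using that(2) by (simp only: T F_normal_eq)
        show "(1, inverse (unity_root m ^ r)) \<in> T K"
          using that(3) by (simp only: T G_normal_eq)
      qed
      then show ?thesis
        using that(4) third[OF that(4)] T by blast
    qed
    show thesis
    proof (rule that[OF norm _ _ mem])
      show "F_normal m k \<in> \<G>"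
        using F by (simp only: T F_normal_eq)
      show "G_normal m r \<in> \<G>"
        using G by (simp only: T G_normal_eq)
      show "[1 + 2 * k = 0] (mod r)" if "B_mat \<in> \<G>"
        by (rule refl) (rule swap[OF _ that])
    qed
  qed
qed

section \<open>Normal forms of the groups of types C and D\<close>

lemma F_mat_diag3: obtains a b c where "F_mat \<mu> \<alpha> \<beta> = diag3 a b c"
  by (auto simp: F_mat_def Let_def)

lemma generate_GL3_incl: "subgroup K GL3 \<Longrightarrow> X \<subseteq> K \<Longrightarrow> generate GL3 X \<subseteq> K"
  by (rule group.generate_subgroup_incl[OF group_GL3])

text \<open>The generator \<open>F_mat \<mu> \<alpha> \<beta>\<close> is a diagonal element of
  \<open>\<G>\<close>, so it lies in every subgroup containing the two normal generators. Both
  inclusions are thus checked on generators, and the identity serves as basis change.\<close>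

lemma type_C_normal_form:
  assumes "type_C \<G>"
  obtains m n k r :: nat
  where "0 < m" "0 < n" "n dvd m" "r = m div n" "k < r" "[1 + k + k ^ 2 = 0] (mod r)"
    "generated_in_some_basis \<G> {E_mat, F_normal m k, G_normal m r}"
proof -
  obtain \<mu> \<alpha> \<beta> where sub: "subgroup \<G> GL3" and SU: "\<G> \<subseteq> SU3" and fin: "finite \<G>"
    and gen: "\<G> = generate GL3 {E_mat, F_mat \<mu> \<alpha> \<beta>}"
    using assms by (auto simp: type_C_def)
  have E: "E_mat \<in> \<G>" and F: "F_mat \<mu> \<alpha> \<beta> \<in> \<G>"
    by (auto simp: gen intro: generate.incl)
  have det: "det A = 1" if "A \<in> \<G>" for A
    using that SU by (auto simp: SU3_def)
  obtain m n k r where norm: "0 < m" "0 < n" "n dvd m" "r = m div n" "k < r" "[1 + k + k ^ 2 = 0] (mod r)"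
    and FG: "F_normal m k \<in> \<G>" "G_normal m r \<in> \<G>"
    and diag: "\<And>K a b c. subgroup K GL3 \<Longrightarrow> F_normal m k \<in> K \<Longrightarrow> G_normal m r \<in> K \<Longrightarrow>
           diag3 a b c \<in> \<G> \<Longrightarrow> diag3 a b c \<in> K"
    by (rule diagonal_subgroup_normal_form[OF sub fin det E]) blast+
  define K where "K = generate GL3 {E_mat, F_normal m k, G_normal m r}"
  have K: "subgroup K GL3"
    unfolding K_def using E FG subgroup.subset[OF sub]
    by (intro group.generate_is_subgroup[OF group_GL3]) auto
  have KI: "E_mat \<in> K" "F_normal m k \<in> K" "G_normal m r \<in> K"
    by (auto simp: K_def intro: generate.incl)
  have "F_mat \<mu> \<alpha> \<beta> \<in> K"
    using F_mat_diag3[of \<mu> \<alpha> \<beta>] F diag[OF K KI(2,3)] by metis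
  then have "\<G> \<subseteq> K"
    unfolding gen using KI by (intro generate_GL3_incl K) auto
  moreover have "K \<subseteq> \<G>"
    unfolding K_def using E FG by (intro generate_GL3_incl sub) auto
  moreover have "(\<lambda>A. mat 1 ** A ** matrix_inv (mat 1)) ` \<G> = \<G>"
    using matrix_inv_diag3[of 1 1 1] by (simp add: diag3_one)
  moreover have "invertible (mat 1 :: cmat3)"
    using invertible_diag3[of 1 1 1] by (simp add: diag3_one)
  ultimately have "generated_in_some_basis \<G> {E_mat, F_normal m k, G_normal m r}"
    unfolding generated_in_some_basis_def K_def by (intro exI[of _ "mat 1"]) auto
  with norm show thesis
    by (rule that)
qed

text \<open>Conjugation by \<open>X\<close> sends \<open>E_mat\<close> and
  \<open>R_mat \<nu> \<rho> \<sigma>\<close> to \<open>E_mat\<close> and \<open>B_mat\<close>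
  multiplied by diagonal elements of \<open>\<G>\<close>. The diagonal normal form is therefore
  applied to the conjugate \<open>\<H>\<close>, which contains \<open>B_mat\<close>.\<close>

lemma type_D_normal_form:
  assumes "type_D \<G>"
  obtains m n k r :: nat
  where "0 < m" "0 < n" "n dvd m" "r = m div n" "k < r" "[1 + k + k ^ 2 = 0] (mod r)"
    "[1 + 2 * k = 0] (mod r)"
    "generated_in_some_basis \<G> {E_mat, F_normal m k, G_normal m r, B_mat}"
proof -
  obtain \<mu> \<alpha> \<beta> \<nu> \<rho> \<sigma> where sub: "subgroup \<G> GL3" and SU: "\<G> \<subseteq> SU3" and fin: "finite \<G>"
    and gen: "\<G> = generate GL3 {E_mat, F_mat \<mu> \<alpha> \<beta>, R_mat \<nu> \<rho> \<sigma>}"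
    using assms unfolding type_D_def by blast
  have E: "E_mat \<in> \<G>" and F: "F_mat \<mu> \<alpha> \<beta> \<in> \<G>" and R: "R_mat \<nu> \<rho> \<sigma> \<in> \<G>"
    by (auto simp: gen intro: generate.incl)
  define x y z where "x = - (unity_root \<nu> ^ \<rho>)" and "y = - (unity_root \<nu> ^ \<sigma>)"
    and "z = unity_root \<nu> powi (- int \<rho> - int \<sigma>)"
  have nz: "x \<noteq> 0" "y \<noteq> 0" "z \<noteq> 0"
    by (simp_all add: x_def y_def z_def)
  have xyz: "x * y * z = 1"
    by (simp add: x_def y_def z_def power_int_diff power_int_minus field_simps)
  define X where "X = diag3 x y z"
  define X' where "X' = diag3 (inverse x) (inverse y) (inverse z)"
  have R_eq: "R_mat \<nu> \<rho> \<sigma> = X ** B_mat"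
    by (simp add: X_def x_def y_def z_def R_mat_eq)
  have invX: "invertible X" and inv_X: "matrix_inv X = X'"
    using nz by (simp_all add: X_def X'_def invertible_diag3 matrix_inv_diag3)

  have R_squared: "diag3 (x * x) (y * z) (z * y) \<in> \<G>"
  proof -
    have "X ** B_mat ** (X ** B_mat) \<in> \<G>"
      using subgroup_GL3_mult[OF sub R R] by (simp add: R_eq)
    also have "X ** B_mat ** (X ** B_mat) = X ** (B_mat ** X) ** B_mat"
      by (simp only: matrix_mul_assoc)
    also have "\<dots> = X ** diag3 x z y ** (B_mat ** B_mat)"
      by (simp add: X_def B_diag3 matrix_mul_assoc)
    finally show ?thesis
      by (simp add: X_def diag3_mult B_squared)
  qed
  have "B_mat ** X' \<in> \<G>"
  proof (rule subgroup_GL3_right_inverse[OF sub R])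
    have "R_mat \<nu> \<rho> \<sigma> ** (B_mat ** X') = X ** (B_mat ** B_mat) ** X'"
      by (simp only: R_eq matrix_mul_assoc)
    then show "R_mat \<nu> \<rho> \<sigma> ** (B_mat ** X') = mat 1"
      using nz by (simp add: B_squared X_def X'_def diag3_inverse)
  qed
  \<comment> \<open>With \<open>R\<close> the third generator, this is \<open>R\<close>
    \<open>E\<close> \<open>R\<close> inverse \<open>E\<close>. The relation \<open>B_E_B\<close>
    and moving both copies of \<open>E\<close> past \<open>X'\<close> produce the cube of
    \<open>E\<close>, leaving a diagonal matrix.\<close>
  then have "X ** B_mat ** E_mat ** (B_mat ** X') ** E_mat \<in> \<G>"
    using subgroup_GL3_mult[OF sub subgroup_GL3_mult[OF sub subgroup_GL3_mult[OF sub R E]] E]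
    unfolding R_eq by blast
  also have "X ** B_mat ** E_mat ** (B_mat ** X') ** E_mat
      = X ** (B_mat ** E_mat ** B_mat) ** X' ** E_mat"
    by (simp only: matrix_mul_assoc)
  also have "\<dots> = X ** (E_mat ** (E_mat ** X')) ** E_mat"
    by (simp only: B_E_B matrix_mul_assoc)
  also have "E_mat ** (E_mat ** X') = diag3 (inverse z) (inverse x) (inverse y) ** E_mat ** E_mat"
    by (metis X'_def E_diag3 matrix_mul_assoc)
  also have "X ** (diag3 (inverse z) (inverse x) (inverse y) ** E_mat ** E_mat) ** E_mat
      = X ** diag3 (inverse z) (inverse x) (inverse y) ** (E_mat ** (E_mat ** E_mat))"
    by (simp only: matrix_mul_assoc)
  finally have "diag3 (x * inverse z) (y * inverse x) (z * inverse y) \<in> \<G>"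
    by (simp add: E_cubed X_def diag3_mult)
  from subgroup_GL3_diag3_inverse[OF sub subgroup_GL3_diag3_rotate[OF sub E this]]
  have p: "diag3 (x * inverse y) (y * inverse z) (z * inverse x) \<in> \<G>"
    using nz by (simp add: field_simps)
  \<comment> \<open>This is the diagonal factor of the conjugate of \<open>R\<close> in
    \<open>hR\<close>. It equals the inverse of \<open>R\<close> squared, times the square of the
    matrix in \<open>p\<close>, times the rotation of that matrix; the entries agree because
    \<open>x * y * z = 1\<close>.\<close>
  have q: "diag3 (x * inverse x * x) (y * inverse z * y) (z * inverse y * z) \<in> \<G>"
  proof -
    have x: "x = inverse (y * z)"
      using xyz by (metis mult.assoc mult.commute inverse_unique)
    note mem = subgroup_GL3_diag3_mult[OF sub subgroup_GL3_diag3_inverse[OF sub R_squared]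
        subgroup_GL3_diag3_mult[OF sub
          subgroup_GL3_diag3_mult[OF sub p p] subgroup_GL3_diag3_rotate[OF sub E p]]]
    have "inverse (x * x) * (x * inverse y * (x * inverse y) * (y * inverse z)) = x * inverse x * x"
      "inverse (y * z) * (y * inverse z * (y * inverse z) * (z * inverse x)) = y * inverse z * y"
      "inverse (z * y) * (z * inverse x * (z * inverse x) * (x * inverse y)) = z * inverse y * z"
      using nz(2,3) unfolding x by (simp_all add: field_simps)
    with mem show ?thesis
      by (simp only:)
  qed

  define h where "h A = X ** A ** matrix_inv X" for A
  interpret h: group_hom GL3 GL3 h
    unfolding h_def by (rule group_hom_conj[OF invX])
  define \<H> where "\<H> = h ` \<G>"
  have h_in: "h A \<in> \<H>" if "A \<in> \<G>" for A
    using that by (simp add: \<H>_def)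
  \<comment> \<open>Diagonal matrices commute with \<open>X\<close>, so the diagonal elements of
    \<open>\<G>\<close>, including those in \<open>p\<close> and \<open>q\<close>, survive unchanged
    in \<open>\<H>\<close>.\<close>
  have h_diag: "h (diag3 a b c) = diag3 a b c" for a b c
    unfolding h_def inv_X using nz by (simp add: X_def X'_def diag3_mult field_simps)
  have diag_h: "diag3 a b c \<in> \<H>" if "diag3 a b c \<in> \<G>" for a b c
    using h_in[OF that] by (simp add: h_diag)
  have hE: "h E_mat = diag3 (x * inverse y) (y * inverse z) (z * inverse x) ** E_mat"
  proof -
    have "h E_mat = X ** (E_mat ** X')"
      by (simp add: h_def inv_X matrix_mul_assoc)
    then show ?thesis
      by (simp add: X_def X'_def E_diag3 diag3_mult matrix_mul_assoc)
  qed
  have hR: "h (R_mat \<nu> \<rho> \<sigma>) = diag3 (x * inverse x * x) (y * inverse z * y) (z * inverse y * z) ** B_mat"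
  proof -
    have "h (R_mat \<nu> \<rho> \<sigma>) = X ** X ** (B_mat ** X')"
      by (simp add: h_def inv_X R_eq matrix_mul_assoc)
    then show ?thesis
      by (simp add: X_def X'_def B_diag3 diag3_mult matrix_mul_assoc mult_ac)
  qed

  have hsub: "subgroup (\<H>) GL3"
    unfolding \<H>_def by (rule h.subgroup_img_is_subgroup[OF sub])
  have cancel: "C \<in> \<H>" if "diag3 a b c ** C \<in> \<H>" "diag3 a b c \<in> \<H>" for a b c C
  proof -
    note n = subgroup_GL3_diag3_nonzero[OF hsub that(2)]
    have "diag3 (inverse a) (inverse b) (inverse c) ** (diag3 a b c ** C) \<in> \<H>"
      by (rule subgroup_GL3_mult[OF hsub subgroup_GL3_diag3_inverse[OF hsub that(2)] that(1)])
    then show ?thesis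
      using n by (simp add: matrix_mul_assoc diag3_inverse)
  qed
  have E': "E_mat \<in> \<H>"
    using cancel[OF _ diag_h[OF p]] h_in[OF E] by (simp add: hE)
  have B': "B_mat \<in> \<H>"
    using cancel[OF _ diag_h[OF q]] h_in[OF R] by (simp only: hR)
  have det: "det A = 1" if A: "A \<in> \<H>" for A
  proof -
    obtain C where C: "C \<in> \<G>" "A = X ** C ** X'"
      using A by (auto simp: \<H>_def h_def inv_X)
    then have "det C = 1"
      using SU by (auto simp: SU3_def)
    with C nz show ?thesis
      by (simp add: det_mul X_def X'_def det_diag3 field_simps)
  qed
  have fin': "finite \<H>"
    using fin by (simp add: \<H>_def)
  obtain m n k r where norm: "0 < m" "0 < n" "n dvd m" "r = m div n" "k < r" "[1 + k + k ^ 2 = 0] (mod r)"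
    and FG: "F_normal m k \<in> \<H>" "G_normal m r \<in> \<H>"
    and diag: "\<And>K a b c. subgroup K GL3 \<Longrightarrow> F_normal m k \<in> K \<Longrightarrow> G_normal m r \<in> K \<Longrightarrow>
           diag3 a b c \<in> \<H> \<Longrightarrow> diag3 a b c \<in> K"
    and refl: "B_mat \<in> \<H> \<Longrightarrow> [1 + 2 * k = 0] (mod r)"
    by (rule diagonal_subgroup_normal_form[OF hsub fin' det E']) blast+
  define K where "K = generate GL3 {E_mat, F_normal m k, G_normal m r, B_mat}"
  have K: "subgroup K GL3"
    unfolding K_def using E' B' FG subgroup.subset[OF hsub]
    by (intro group.generate_is_subgroup[OF group_GL3]) auto
  have KI: "E_mat \<in> K" "F_normal m k \<in> K" "G_normal m r \<in> K" "B_mat \<in> K"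
    by (auto simp: K_def intro: generate.incl)
  have diagK: "diag3 a b c \<in> K" if "diag3 a b c \<in> \<G>" for a b c
    using diag[OF K KI(2,3) diag_h[OF that]] .
  have "h E_mat \<in> K" "h (R_mat \<nu> \<rho> \<sigma>) \<in> K"
    unfolding hE hR by (intro subgroup_GL3_mult[OF K] diagK p q KI)+
  moreover have "h (F_mat \<mu> \<alpha> \<beta>) \<in> K"
    using F_mat_diag3[of \<mu> \<alpha> \<beta>] F diagK h_diag by metis
  \<comment> \<open>A homomorphism maps a generated subgroup onto the one generated by the images,
    so \<open>\<H> \<subseteq> K\<close> needs checking on three matrices only.\<close>
  moreover have "\<H> = generate GL3 (h ` {E_mat, F_mat \<mu> \<alpha> \<beta>, R_mat \<nu> \<rho> \<sigma>})"
    unfolding \<H>_def gen using subgroup.subset[OF sub] E F R by (intro h.generate_img[symmetric]) auto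
  ultimately have "\<H> \<subseteq> K"
    using generate_GL3_incl[OF K] by simp
  moreover have "K \<subseteq> \<H>"
    unfolding K_def using E' B' FG by (intro generate_GL3_incl hsub) auto
  ultimately have "generated_in_some_basis \<G> {E_mat, F_normal m k, G_normal m r, B_mat}"
    unfolding generated_in_some_basis_def K_def \<H>_def h_def using invX by (intro exI[of _ X]) auto
  with norm refl[OF B'] show thesis
    by (rule that)
qed

theorem theorem2:
  fixes \<G> :: "cmat3 set"
  shows "(type_C \<G> \<longrightarrow>
           (\<exists>m n k r :: nat. 0 < m \<and> 0 < n \<and> n dvd m \<and> r = m div n \<and> k < r \<and>
              [1 + k + k ^ 2 = 0] (mod r) \<and>
              generated_in_some_basis \<G> {E_mat, F_normal m k, G_normal m r})) \<and>
         (type_D \<G> \<longrightarrow>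
           (\<exists>m n k r :: nat. 0 < m \<and> 0 < n \<and> n dvd m \<and> r = m div n \<and> k < r \<and>
              [1 + k + k ^ 2 = 0] (mod r) \<and> [1 + 2 * k = 0] (mod r) \<and>
              generated_in_some_basis \<G> {E_mat, F_normal m k, G_normal m r, B_mat}))"
proof (intro conjI impI)
  assume "type_C \<G>"
  then obtain m n k r where "0 < m" "0 < n" "n dvd m" "r = m div n" "k < r" "[1 + k + k ^ 2 = 0] (mod r)"
    "generated_in_some_basis \<G> {E_mat, F_normal m k, G_normal m r}"
    by (rule type_C_normal_form)
  then show "\<exists>m n k r. 0 < m \<and> 0 < n \<and> n dvd m \<and> r = m div n \<and> k < r \<and>
      [1 + k + k ^ 2 = 0] (mod r) \<and>
      generated_in_some_basis \<G> {E_mat, F_normal m k, G_normal m r}"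
    by (intro exI[of _ m] exI[of _ n] exI[of _ k] exI[of _ r] conjI)
next
  assume "type_D \<G>"
  then obtain m n k r where "0 < m" "0 < n" "n dvd m" "r = m div n" "k < r" "[1 + k + k ^ 2 = 0] (mod r)"
    "[1 + 2 * k = 0] (mod r)"
    "generated_in_some_basis \<G> {E_mat, F_normal m k, G_normal m r, B_mat}"
    by (rule type_D_normal_form)
  then show "\<exists>m n k r. 0 < m \<and> 0 < n \<and> n dvd m \<and> r = m div n \<and> k < r \<and>
      [1 + k + k ^ 2 = 0] (mod r) \<and> [1 + 2 * k = 0] (mod r) \<and>
      generated_in_some_basis \<G> {E_mat, F_normal m k, G_normal m r, B_mat}"
    by (intro exI[of _ m] exI[of _ n] exI[of _ k] exI[of _ r] conjI)
qed

end
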